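(* Let $\Omega\subset\mathbb{R}^d$ ($d=2,3$) be a bounded two-phase conducting body with real scalar phase conductivities $\sigma_1\neq\sigma_2$, volume fractions $f_1,f_2>0$ and breakdown thresholds $c^{(1)},c^{(2)}>0$, and let $V$ solve the source-free conductivity equations in $\Omega$, with $\mathbf{E}=-\nabla V$ and $\mathbf{J}=\sigma\mathbf{E}$. Define from the boundary data the vectors $$\langle\mathbf{E}\rangle=-\frac{1}{|\Omega|}\int_{\partial\Omega}V\,\mathbf{n}\,dS,\qquad \langle\mathbf{J}\rangle=\frac{1}{|\Omega|}\int_{\partial\Omega}\mathbf{x}\,(\mathbf{J}\cdot\mathbf{n})\,dS,$$ $$\langle\mathbf{E}\rangle_1=\frac{\langle\mathbf{J}\rangle-\sigma_2\langle\mathbf{E}\rangle}{f_1(\sigma_1-\sigma_2)},\qquad \langle\mathbf{E}\rangle_2=\frac{\langle\mathbf{J}\rangle-\sigma_1\langle\mathbf{E}\rangle}{f_2(\sigma_2-\sigma_1)}.$$ Then $\langle\mathbf{E}\rangle_\alpha$ is the average of $\mathbf{E}$ over phase $\alpha$, and if neither phase has broken down, then $|\langle\mathbf{E}\rangle_\alpha|\le c^{(\alpha)}$ for $\alpha=1,2$.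
   Context: Phase $\alpha$ occupies $\Omega_\alpha\subset\Omega$ with characteristic function $\chi_\alpha$, where $\chi_1+\chi_2=1$ in $\Omega$ up to measure zero, and $f_\alpha=|\Omega_\alpha|/|\Omega|$. The source-free conductivity equations are $\mathbf{J}=\sigma\mathbf{E}$, $\nabla\cdot\mathbf{J}=0$, $\mathbf{E}=-\nabla V$ with $\sigma=\sigma_1\chi_1+\sigma_2\chi_2$ (solutions in the weak sense, on a domain regular enough for the divergence theorem). $\mathbf{n}$ is the outward unit normal to $\partial\Omega$. The average of $\mathbf{E}$ over phase $\alpha$ is $\frac{1}{|\Omega_\alpha|}\int_{\Omega_\alpha}\mathbf{E}\,d\mathbf{x}$. Neither phase has broken down means $|\mathbf{E}(\mathbf{x})|<c^{(\alpha)}$ at (almost) every $\mathbf{x}\in\Omega_\alpha$, $\alpha=1,2$. *)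

theory Defs
  imports "HOL-Analysis.Analysis"
begin

section \<open>Hausdorff measure and surface integration\<close>

text \<open>
  \<open>hausdorff_pre m \<delta>\<close> and \<open>hausdorff_outer m\<close> are the usual \<open>m\<close>-dimensional Hausdorff
  (pre-)measures for \<open>m \<ge> 1\<close>, normalised by the volume of the \<open>m\<close>-dimensional unit ball so that
  they agree with Lebesgue measure on \<open>m\<close>-planes and with length and area for \<open>m = 1, 2\<close>.
  Boundedness is required explicitly because \<^const>\<open>diameter\<close> is unspecified on unbounded sets.
\<close>

definition hausdorff_pre :: "nat \<Rightarrow> real \<Rightarrow> 'a::metric_space set \<Rightarrow> ennreal" where
  "hausdorff_pre m \<delta> A =
     (INF C \<in> {C :: nat \<Rightarrow> 'a set. A \<subseteq> (\<Union>k. C k) \<and> (\<forall>k. bounded (C k) \<and> diameter (C k) \<le> \<delta>)}.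
        \<Sum>k. ennreal (unit_ball_vol (real m) * (diameter (C k) / 2) ^ m))"

definition hausdorff_outer :: "nat \<Rightarrow> 'a::metric_space set \<Rightarrow> ennreal" where
  "hausdorff_outer m A = (SUP \<delta> \<in> {0<..}. hausdorff_pre m \<delta> A)"

text \<open>
  The Hausdorff outer measure is a metric outer measure, hence countably additive on Borel sets,
  so that \<^const>\<open>measure_of\<close> keeps its values there.
\<close>

definition hausdorff_measure :: "nat \<Rightarrow> 'a::metric_space measure" where
  "hausdorff_measure m = measure_of UNIV (sets borel) (hausdorff_outer m)"

definition surface_measure :: "'a::euclidean_space set \<Rightarrow> 'a measure" where
  "surface_measure \<Omega> = restrict_space (hausdorff_measure (DIM('a) - 1)) (frontier \<Omega>)"

text \<open>
  The outward unit normal in Federer's sense: to leading order as \<open>r\<close> tends to \<open>0\<close>, the part of the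
  ball of radius \<open>r\<close> about \<open>x\<close> lying in \<open>\<Omega>\<close> is the half ball opposite to \<open>\<nu>\<close>.  It is unique
  where it exists, and is the classical normal at points where the boundary is a \<open>C\<^sup>1\<close> graph
  with \<open>\<Omega>\<close> on one side.
\<close>

definition outward_unit_normal_at :: "'a::euclidean_space set \<Rightarrow> 'a \<Rightarrow> 'a \<Rightarrow> bool" where
  "outward_unit_normal_at \<Omega> x \<nu> \<longleftrightarrow>
     norm \<nu> = 1 \<and>
     ((\<lambda>r. measure lebesgue {y \<in> ball x r. y \<in> \<Omega> \<and> (y - x) \<bullet> \<nu> > 0} / r ^ DIM('a)) \<longlongrightarrow> 0) (at_right 0) \<and>
     ((\<lambda>r. measure lebesgue {y \<in> ball x r. y \<notin> \<Omega> \<and> (y - x) \<bullet> \<nu> < 0} / r ^ DIM('a)) \<longlongrightarrow> 0) (at_right 0)"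


section \<open>Differential operators and the divergence theorem\<close>

primrec C_k :: "nat \<Rightarrow> ('a::euclidean_space \<Rightarrow> 'b::real_normed_vector) \<Rightarrow> bool" where
  "C_k 0 f = continuous_on UNIV f"
| "C_k (Suc k) f = ((\<forall>x. f differentiable (at x)) \<and> (\<forall>v. C_k k (\<lambda>x. frechet_derivative f (at x) v)))"

definition grad :: "(real^'n \<Rightarrow> real) \<Rightarrow> real^'n \<Rightarrow> real^'n" where
  "grad f x = (\<chi> i. frechet_derivative f (at x) (axis i 1))"

definition divergence :: "(real^'n \<Rightarrow> real^'n) \<Rightarrow> real^'n \<Rightarrow> real" where
  "divergence F x = (\<Sum>i\<in>UNIV. frechet_derivative F (at x) (axis i 1) $ i)"

text \<open>
  A bounded open set regular enough for the divergence theorem, with outward normal \<open>\<nu>\<close>.  Every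
  bounded Lipschitz domain is an instance.
\<close>

definition divergence_theorem_domain :: "(real^'n) set \<Rightarrow> (real^'n \<Rightarrow> real^'n) \<Rightarrow> bool" where
  "divergence_theorem_domain \<Omega> \<nu> \<longleftrightarrow>
     open \<Omega> \<and> bounded \<Omega> \<and>
     emeasure (surface_measure \<Omega>) (frontier \<Omega>) < \<infinity> \<and>
     \<nu> \<in> borel_measurable (surface_measure \<Omega>) \<and>
     (AE x in surface_measure \<Omega>. outward_unit_normal_at \<Omega> x (\<nu> x)) \<and>
     (\<forall>F. C_k 1 F \<longrightarrow>
        (LINT x|lebesgue_on \<Omega>. divergence F x) = (LINT x|surface_measure \<Omega>. F x \<bullet> \<nu> x))"


section \<open>Weak derivatives and boundary values\<close>

definition test_function :: "(real^'n) set \<Rightarrow> (real^'n \<Rightarrow> real) \<Rightarrow> bool" where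
  "test_function \<Omega> \<phi> \<longleftrightarrow>
     (\<forall>k. C_k k \<phi>) \<and> (\<exists>K. compact K \<and> K \<subseteq> \<Omega> \<and> (\<forall>x. x \<notin> K \<longrightarrow> \<phi> x = 0))"

definition square_integrable_on :: "('a::euclidean_space \<Rightarrow> 'b::euclidean_space) \<Rightarrow> 'a set \<Rightarrow> bool" where
  "square_integrable_on f \<Omega> \<longleftrightarrow>
     f \<in> borel_measurable (lebesgue_on \<Omega>) \<and> integrable (lebesgue_on \<Omega>) (\<lambda>x. (norm (f x))\<^sup>2)"

definition L2_tendsto ::
    "'a::euclidean_space set \<Rightarrow> (nat \<Rightarrow> 'a \<Rightarrow> 'b::euclidean_space) \<Rightarrow> ('a \<Rightarrow> 'b) \<Rightarrow> bool" where
  "L2_tendsto \<Omega> f g \<longleftrightarrow>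
     (\<lambda>k. \<integral>\<^sup>+x. ennreal ((norm (f k x - g x))\<^sup>2) \<partial>lebesgue_on \<Omega>) \<longlonglongrightarrow> 0"

text \<open>\<open>u\<close> belongs to the Sobolev space \<open>H\<^sup>1(\<Omega>)\<close> and has weak gradient \<open>G\<close>.\<close>

definition weak_gradient :: "(real^'n) set \<Rightarrow> (real^'n \<Rightarrow> real) \<Rightarrow> (real^'n \<Rightarrow> real^'n) \<Rightarrow> bool" where
  "weak_gradient \<Omega> u G \<longleftrightarrow>
     square_integrable_on u \<Omega> \<and> square_integrable_on G \<Omega> \<and>
     (\<forall>\<phi>. test_function \<Omega> \<phi> \<longrightarrow>
        (LINT x|lebesgue_on \<Omega>. u x *\<^sub>R grad \<phi> x) = - (LINT x|lebesgue_on \<Omega>. \<phi> x *\<^sub>R G x))"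

definition weakly_divergence_free :: "(real^'n) set \<Rightarrow> (real^'n \<Rightarrow> real^'n) \<Rightarrow> bool" where
  "weakly_divergence_free \<Omega> F \<longleftrightarrow>
     square_integrable_on F \<Omega> \<and>
     (\<forall>\<phi>. test_function \<Omega> \<phi> \<longrightarrow> (LINT x|lebesgue_on \<Omega>. F x \<bullet> grad \<phi> x) = 0)"

text \<open>
  Boundary values of a function \<open>u\<close> in \<open>H\<^sup>1(\<Omega>)\<close> with weak gradient \<open>G\<close>: the trace \<open>g\<close> is the
  limit of the restrictions to the boundary of functions that are \<open>C\<^sup>1\<close> up to the boundary and
  converge to \<open>u\<close> in \<open>H\<^sup>1(\<Omega>)\<close>, that is, the extension by continuity of the restriction map.
\<close>

definition boundary_trace ::
    "(real^'n) set \<Rightarrow> (real^'n \<Rightarrow> real) \<Rightarrow> (real^'n \<Rightarrow> real^'n) \<Rightarrow> (real^'n \<Rightarrow> real) \<Rightarrow> bool" where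
  "boundary_trace \<Omega> u G g \<longleftrightarrow>
     integrable (surface_measure \<Omega>) g \<and>
     (\<exists>U. (\<forall>k. C_k 1 (U k)) \<and>
        L2_tendsto \<Omega> U u \<and> L2_tendsto \<Omega> (\<lambda>k. grad (U k)) G \<and>
        (\<lambda>k. \<integral>\<^sup>+x. ennreal \<bar>U k x - g x\<bar> \<partial>surface_measure \<Omega>) \<longlonglongrightarrow> 0)"

text \<open>
  For a square integrable field \<open>F\<close> with weak divergence \<open>w\<close> in \<open>L\<^sup>2(\<Omega>)\<close>, the flux density
  \<open>F \<cdot> n\<close> on the boundary is in general not a function but an element of \<open>H\<^sup>-\<^sup>1\<^sup>/\<^sup>2(\<partial>\<Omega>)\<close>.
  It is therefore represented by the functional \<open>\<Lambda>\<close>, where \<open>\<Lambda> \<phi>\<close> is the boundary integral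
  of \<open>\<phi> (F \<cdot> n)\<close> extended by continuity from fields that are \<open>C\<^sup>1\<close> up to the boundary; see
  \<open>normal_trace_C1\<close> below for such fields.
\<close>

definition normal_trace ::
    "(real^'n) set \<Rightarrow> (real^'n \<Rightarrow> real^'n) \<Rightarrow> (real^'n \<Rightarrow> real^'n) \<Rightarrow> (real^'n \<Rightarrow> real)
       \<Rightarrow> ((real^'n \<Rightarrow> real) \<Rightarrow> real) \<Rightarrow> bool" where
  "normal_trace \<Omega> \<nu> F w \<Lambda> \<longleftrightarrow>
     (\<exists>P. (\<forall>k. C_k 1 (P k)) \<and>
        L2_tendsto \<Omega> P F \<and> L2_tendsto \<Omega> (\<lambda>k. divergence (P k)) w \<and>
        (\<forall>\<phi>. C_k 1 \<phi> \<longrightarrow>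
           (\<lambda>k. LINT x|surface_measure \<Omega>. \<phi> x * (P k x \<bullet> \<nu> x)) \<longlonglongrightarrow> \<Lambda> \<phi>))"

lemma normal_trace_C1:
  assumes "C_k 1 F"
  shows "normal_trace \<Omega> \<nu> F (divergence F) (\<lambda>\<phi>. LINT x|surface_measure \<Omega>. \<phi> x * (F x \<bullet> \<nu> x))"
  unfolding normal_trace_def L2_tendsto_def
  by (rule exI[of _ "\<lambda>_. F"]) (use assms in simp)

end

theory Submission
  imports Defs
begin

text \<open>
  For fields that are \<open>C\<^sup>1\<close> up to the boundary, the divergence theorem applied to \<open>u e\<^sub>i\<close> and to
  \<open>x\<^sub>i F\<close> identifies the boundary integrals of \<open>u n\<close> and \<open>x (F \<cdot> n)\<close> with the volume integrals of
  \<open>\<nabla>u\<close> and \<open>F + x (\<nabla> \<cdot> F)\<close>.  Convergence in \<open>L\<^sup>2(\<Omega>)\<close> implies convergence of integrals since \<open>\<Omega>\<close>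
  has finite measure, so both identities pass to traces, and \<open>\<langle>E\<rangle>\<close> and \<open>\<langle>J\<rangle>\<close> are the volume averages
  of \<open>E\<close> and \<open>J\<close>.  With \<open>I\<^sub>\<alpha>\<close> the integral of \<open>E\<close> over phase \<open>\<alpha>\<close>, these averages are
  \<open>(I\<^sub>1 + I\<^sub>2) / |\<Omega>|\<close> and \<open>(\<sigma>\<^sub>1 I\<^sub>1 + \<sigma>\<^sub>2 I\<^sub>2) / |\<Omega>|\<close>, a linear system that determines \<open>I\<^sub>1\<close> and \<open>I\<^sub>2\<close>.
\<close>

section \<open>From L^2 convergence to convergence of integrals on finite measure spaces\<close>

lemma (in finite_measure) L2_imp_L1_tendsto_zero:
  fixes f :: "nat \<Rightarrow> 'a \<Rightarrow> 'b::euclidean_space"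
  assumes [measurable]: "\<And>k. f k \<in> borel_measurable M"
    and lim: "(\<lambda>k. \<integral>\<^sup>+x. ennreal ((norm (f k x))\<^sup>2) \<partial>M) \<longlonglongrightarrow> 0"
  shows "(\<lambda>k. \<integral>\<^sup>+x. ennreal (norm (f k x)) \<partial>M) \<longlonglongrightarrow> 0"
proof -
  let ?a = "\<lambda>k. \<integral>\<^sup>+x. ennreal (norm (f k x)) \<partial>M"
  \<comment> \<open>Cauchy-Schwarz against the constant function 1, whose squared L^2 norm is the
    total mass.\<close>
  have le: "(?a k)\<^sup>2 \<le> emeasure M (space M) * (\<integral>\<^sup>+x. ennreal ((norm (f k x))\<^sup>2) \<partial>M)" for k
    using Cauchy_Schwarz_nn_integral[of "\<lambda>x. ennreal (norm (f k x))" M "\<lambda>_. 1"]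
    by (simp add: ennreal_power mult.commute)
  \<comment> \<open>An infinite factor would turn every positive term into infinity, so the limit 0
    rests on finite mass.\<close>
  have "emeasure M (space M) < top"
    by (simp add: less_top[symmetric])
  then have "(\<lambda>k. emeasure M (space M) * (\<integral>\<^sup>+x. ennreal ((norm (f k x))\<^sup>2) \<partial>M)) \<longlonglongrightarrow> 0"
    using ennreal_tendsto_cmult[OF _ lim] by fastforce
  from tendsto_sandwich[OF _ _ tendsto_const this] have sq: "(\<lambda>k. (?a k)\<^sup>2) \<longlonglongrightarrow> 0"
    by (simp add: le)
  \<comment> \<open>The square is undone by comparing thresholds: if \<open>?a k\<close> were at
    least \<open>c\<close>, its square would be at least \<open>c\<^sup>2\<close>.\<close>
  show ?thesis
  proof (rule order_tendstoI)
    fix c :: ennreal assume "0 < c"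
    then have "0 < c\<^sup>2" by (simp add: power2_eq_square ennreal_zero_less_mult_iff)
    then have "\<forall>\<^sub>F k in sequentially. (?a k)\<^sup>2 < c\<^sup>2"
      using order_tendstoD(2)[OF sq] by simp
    then show "\<forall>\<^sub>F k in sequentially. ?a k < c"
      by eventually_elim (meson not_le power_mono zero_le)
  qed simp
qed

lemma L2_tendsto_imp_L1:
  fixes f :: "nat \<Rightarrow> 'a::euclidean_space \<Rightarrow> 'b::euclidean_space"
  assumes "\<Omega> \<in> lmeasurable"
    and "\<And>k. f k \<in> borel_measurable (lebesgue_on \<Omega>)" "g \<in> borel_measurable (lebesgue_on \<Omega>)"
    and "L2_tendsto \<Omega> f g"
  shows "(\<lambda>k. \<integral>\<^sup>+x. ennreal (norm (f k x - g x)) \<partial>lebesgue_on \<Omega>) \<longlonglongrightarrow> 0"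
proof -
  interpret finite_measure "lebesgue_on \<Omega>"
    by (rule finite_measure_lebesgue_on[OF assms(1)])
  show ?thesis
    by (rule L2_imp_L1_tendsto_zero) (use assms in \<open>auto simp: L2_tendsto_def\<close>)
qed

lemma L2_tendsto_integral:
  fixes f :: "nat \<Rightarrow> 'a::euclidean_space \<Rightarrow> 'b::euclidean_space"
  assumes "\<Omega> \<in> lmeasurable"
    and "\<And>k. integrable (lebesgue_on \<Omega>) (f k)" "integrable (lebesgue_on \<Omega>) g"
    and "L2_tendsto \<Omega> f g"
  shows "(\<lambda>k. LINT x|lebesgue_on \<Omega>. f k x) \<longlonglongrightarrow> (LINT x|lebesgue_on \<Omega>. g x)"
  using assms by (intro tendsto_L1_int L2_tendsto_imp_L1) auto

lemma square_integrable_on_imp_integrable: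
  assumes "\<Omega> \<in> lmeasurable" "square_integrable_on f \<Omega>"
  shows "integrable (lebesgue_on \<Omega>) f"
proof -
  interpret finite_measure "lebesgue_on \<Omega>"
    by (rule finite_measure_lebesgue_on[OF assms(1)])
  have meas: "f \<in> borel_measurable (lebesgue_on \<Omega>)"
    using assms(2) by (simp add: square_integrable_on_def)
  \<comment> \<open>The scalar fact is applied to the norm; measurability of \<open>f\<close> then
    carries integrability back to the vector field.\<close>
  have "integrable (lebesgue_on \<Omega>) (\<lambda>x. norm (f x))"
    by (rule square_integrable_imp_integrable)
       (use assms(2) meas in \<open>auto simp: square_integrable_on_def\<close>)
  with meas show ?thesis
    by (simp add: integrable_norm_iff)
qed

text \<open>The closure of \<open>S\<close> is compact by Heine-Borel, so its continuous image is
  bounded.\<close>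

lemma continuous_bounded_on_bounded:
  fixes f :: "'a::heine_borel \<Rightarrow> 'b::real_normed_vector"
  assumes "bounded S" "continuous_on UNIV f"
  obtains B where "B > 0" "\<And>x. x \<in> S \<Longrightarrow> norm (f x) \<le> B"
proof -
  have "bounded (f ` closure S)"
    using assms by (meson compact_closure compact_continuous_image compact_imp_bounded
        continuous_on_subset subset_UNIV)
  then obtain B where "B > 0" "\<And>x. x \<in> closure S \<Longrightarrow> norm (f x) \<le> B"
    by (auto simp: bounded_pos)
  then show thesis
    using that closure_subset by blast
qed

lemma integrable_continuous_lebesgue_on:
  fixes f :: "'a::euclidean_space \<Rightarrow> 'b::euclidean_space"
  assumes "\<Omega> \<in> lmeasurable" "bounded \<Omega>" "continuous_on UNIV f"
  shows "integrable (lebesgue_on \<Omega>) f"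
proof -
  interpret finite_measure "lebesgue_on \<Omega>"
    by (rule finite_measure_lebesgue_on[OF assms(1)])
  obtain B where "\<And>x. x \<in> \<Omega> \<Longrightarrow> norm (f x) \<le> B"
    using continuous_bounded_on_bounded[OF assms(2,3)] by blast
  moreover have "f \<in> borel_measurable (lebesgue_on \<Omega>)"
    using assms by (intro continuous_imp_measurable_on_sets_lebesgue)
      (auto intro: continuous_on_subset)
  ultimately show ?thesis
    by (intro integrable_const_bound[of _ B]) auto
qed

section \<open>Measurability on the boundary\<close>

lemma space_surface_measure [simp]: "space (surface_measure \<Omega>) = frontier \<Omega>"
  by (simp add: surface_measure_def hausdorff_measure_def space_restrict_space space_measure_of_conv)

text \<open>\<open>hausdorff_measure\<close> carries the sigma-algebra generated by
  \<open>sets borel\<close>, which is Borel again, and restriction to the frontier preserves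
  measurability.\<close>

lemma measurable_surface_measure_continuous:
  fixes f :: "'a::euclidean_space \<Rightarrow> 'b::topological_space"
  assumes "continuous_on UNIV f"
  shows "f \<in> borel_measurable (surface_measure \<Omega>)"
proof -
  have "sets (hausdorff_measure m :: 'a measure) = sets borel" for m
    using sets.sigma_sets_eq[of "borel :: 'a measure"]
    by (simp add: hausdorff_measure_def sets_measure_of_conv)
  then have "borel_measurable (hausdorff_measure m :: 'a measure)
      = (borel_measurable borel :: ('a \<Rightarrow> 'b) set)" for m
    by (rule measurable_cong_sets) simp
  then show ?thesis
    unfolding surface_measure_def
    using borel_measurable_continuous_onI[OF assms] by (intro measurable_restrict_space1) simp
qed

section \<open>Calculus of C^1 functions and fields\<close>

lemma C_k_1_iff:
  "C_k 1 f \<longleftrightarrow> (\<forall>x. f differentiable (at x)) \<and>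
     (\<forall>v. continuous_on UNIV (\<lambda>x. frechet_derivative f (at x) v))"
  by simp

lemma C_k_1_continuous:
  assumes "C_k 1 f"
  shows "continuous_on UNIV f"
  using assms by (auto simp: C_k_1_iff intro!: differentiable_imp_continuous_on
      differentiable_at_imp_differentiable_on)

lemma continuous_grad:
  assumes "C_k 1 u"
  shows "continuous_on UNIV (grad u)"
  using assms unfolding grad_def[abs_def] C_k_1_iff by (intro continuous_on_vec_lambda) auto

lemma continuous_divergence:
  assumes "C_k 1 F"
  shows "continuous_on UNIV (divergence F)"
  using assms unfolding divergence_def[abs_def] C_k_1_iff
  by (intro continuous_intros) auto

lemma C_k_1_const: "C_k 1 (\<lambda>x. c)"
  by (simp add: C_k_1_iff)

lemma frechet_derivative_component:
  "frechet_derivative (\<lambda>x::real^'n. x $ i) (at x) = (\<lambda>h. h $ i)"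
  by (rule frechet_derivative_at[symmetric])
     (rule bounded_linear_imp_has_derivative[OF bounded_linear_vec_nth])

text \<open>Makes the coordinates admissible weights in \<open>normal_trace\<close>, where they
  yield the first moments of the flux.\<close>

lemma C_k_1_component: "C_k 1 (\<lambda>x::real^'n. x $ i)"
  unfolding C_k_1_iff frechet_derivative_component
  by (auto intro: bounded_linear_imp_differentiable bounded_linear_vec_nth)

lemma grad_component: "grad (\<lambda>x::real^'n. x $ i) x = axis i 1"
  by (simp add: grad_def frechet_derivative_component axis_def vec_eq_iff)

lemma divergence_const: "divergence (\<lambda>x. c) x = 0"
  by (simp add: divergence_def)

text \<open>The product rule holds for \<open>has_derivative\<close>; uniqueness of the derivative
  turns it into an equation for the chosen \<open>frechet_derivative\<close>.\<close>

lemma frechet_derivative_scaleR: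
  assumes "\<phi> differentiable (at x)" "F differentiable (at x)"
  shows "frechet_derivative (\<lambda>x. \<phi> x *\<^sub>R F x) (at x) =
    (\<lambda>h. \<phi> x *\<^sub>R frechet_derivative F (at x) h + frechet_derivative \<phi> (at x) h *\<^sub>R F x)"
  using assms unfolding frechet_derivative_works
  by (intro frechet_derivative_at[symmetric] has_derivative_scaleR)

lemma C_k_1_scaleR:
  assumes "C_k 1 \<phi>" "C_k 1 F"
  shows "C_k 1 (\<lambda>x. \<phi> x *\<^sub>R F x)"
proof -
  have "(\<lambda>x. \<phi> x *\<^sub>R F x) differentiable (at x)" for x
    using assms by (auto simp: C_k_1_iff intro: differentiable_scaleR)
  moreover have "continuous_on UNIV (\<lambda>x. frechet_derivative (\<lambda>x. \<phi> x *\<^sub>R F x) (at x) v)" for v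
    using assms C_k_1_continuous[OF assms(1)] C_k_1_continuous[OF assms(2)]
    by (auto simp: frechet_derivative_scaleR C_k_1_iff intro!: continuous_intros)
  ultimately show ?thesis
    by (simp add: C_k_1_iff)
qed

lemma divergence_scaleR:
  assumes "C_k 1 \<phi>" "C_k 1 F"
  shows "divergence (\<lambda>x. \<phi> x *\<^sub>R F x) x = grad \<phi> x \<bullet> F x + \<phi> x * divergence F x"
  using assms
  by (simp add: divergence_def grad_def C_k_1_iff frechet_derivative_scaleR inner_vec_def
      sum.distrib sum_distrib_left)

section \<open>Integral identities on the domain and their extension to traces\<close>

context
  fixes \<Omega> :: "(real^'n) set" and \<nu> :: "real^'n \<Rightarrow> real^'n"
  assumes dom: "divergence_theorem_domain \<Omega> \<nu>"
begin

lemma domain_lmeasurable: "\<Omega> \<in> lmeasurable" and domain_bounded: "bounded \<Omega>"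
  using dom by (auto simp: divergence_theorem_domain_def intro: lmeasurable_open)

lemma finite_surface_measure: "finite_measure (surface_measure \<Omega>)"
  using dom by (intro finite_measureI) (auto simp: divergence_theorem_domain_def)

lemma normal_measurable: "\<nu> \<in> borel_measurable (surface_measure \<Omega>)"
  using dom by (simp add: divergence_theorem_domain_def)

lemma norm_normal: "AE x in surface_measure \<Omega>. norm (\<nu> x) = 1"
  using dom by (auto simp: divergence_theorem_domain_def outward_unit_normal_at_def)

lemma integrable_scaleR_normal:
  assumes "integrable (surface_measure \<Omega>) u"
  shows "integrable (surface_measure \<Omega>) (\<lambda>x. u x *\<^sub>R \<nu> x)"
proof (rule Bochner_Integration.integrable_bound[OF assms])
  show "(\<lambda>x. u x *\<^sub>R \<nu> x) \<in> borel_measurable (surface_measure \<Omega>)"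
    using assms normal_measurable by measurable
  \<comment> \<open>The normal has unit length almost everywhere, so \<open>u\<close> itself
    dominates the product.\<close>
  show "AE x in surface_measure \<Omega>. norm (u x *\<^sub>R \<nu> x) \<le> norm (u x)"
    using norm_normal by eventually_elim simp
qed

lemma integrable_surface_continuous:
  fixes u :: "real^'n \<Rightarrow> real"
  assumes "continuous_on UNIV u"
  shows "integrable (surface_measure \<Omega>) u"
proof -
  interpret finite_measure "surface_measure \<Omega>"
    by (rule finite_surface_measure)
  obtain B where "\<And>x. x \<in> frontier \<Omega> \<Longrightarrow> norm (u x) \<le> B"
    using continuous_bounded_on_bounded[OF compact_imp_bounded[OF
        compact_frontier_bounded[OF domain_bounded]] assms] by blast
  then show ?thesis
    using assms by (intro integrable_const_bound[of _ B] measurable_surface_measure_continuous) auto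
qed

text \<open>The divergence theorem for the product field, expanded by the Leibniz rule. A constant
  \<open>F\<close> gives the gradient theorem, and a coordinate \<open>\<phi>\<close> gives the flux
  identity.\<close>

lemma integration_by_parts:
  assumes "C_k 1 \<phi>" "C_k 1 F"
  shows "(LINT x|lebesgue_on \<Omega>. grad \<phi> x \<bullet> F x + \<phi> x * divergence F x)
    = (LINT x|surface_measure \<Omega>. \<phi> x * (F x \<bullet> \<nu> x))"
proof -
  have "(LINT x|lebesgue_on \<Omega>. divergence (\<lambda>x. \<phi> x *\<^sub>R F x) x)
      = (LINT x|surface_measure \<Omega>. (\<phi> x *\<^sub>R F x) \<bullet> \<nu> x)"
    using dom C_k_1_scaleR[OF assms] unfolding divergence_theorem_domain_def by blast
  then show ?thesis
    by (simp add: divergence_scaleR[OF assms])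
qed

lemma gradient_theorem:
  assumes "C_k 1 u"
  shows "(LINT x|lebesgue_on \<Omega>. grad u x) = (LINT x|surface_measure \<Omega>. u x *\<^sub>R \<nu> x)"
proof (rule vec_eq_iff[THEN iffD2], rule allI)
  fix i
  \<comment> \<open>Taking a component commutes with the integral because the continuous gradient is
    integrable on the bounded domain.\<close>
  have "(LINT x|lebesgue_on \<Omega>. grad u x) $ i = (LINT x|lebesgue_on \<Omega>. grad u x \<bullet> axis i 1)"
    using integrable_continuous_lebesgue_on[OF domain_lmeasurable domain_bounded continuous_grad[OF assms]]
    by (simp add: inner_axis flip: integral_bounded_linear[OF bounded_linear_vec_nth])
  also have "\<dots> = (LINT x|surface_measure \<Omega>. u x * (axis i 1 \<bullet> \<nu> x))"
    using integration_by_parts[OF assms C_k_1_const[of "axis i 1"]] by (simp add: divergence_const)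
  also have "\<dots> = (LINT x|surface_measure \<Omega>. u x *\<^sub>R \<nu> x) $ i"
    using integrable_scaleR_normal[OF integrable_surface_continuous[OF C_k_1_continuous[OF assms]]]
    by (simp add: inner_axis' flip: integral_bounded_linear[OF bounded_linear_vec_nth])
  finally show "(LINT x|lebesgue_on \<Omega>. grad u x) $ i
      = (LINT x|surface_measure \<Omega>. u x *\<^sub>R \<nu> x) $ i" .
qed

text \<open>Both sides of the gradient theorem for the approximants \<open>U k\<close> converge: the
  gradients in L^2 of the domain, the boundary values in L^1 of the surface. Limits are
  unique.\<close>

lemma integral_boundary_trace:
  assumes trace: "boundary_trace \<Omega> u G g" and G: "integrable (lebesgue_on \<Omega>) G"
  shows "(LINT x|lebesgue_on \<Omega>. G x) = (LINT x|surface_measure \<Omega>. g x *\<^sub>R \<nu> x)"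
proof -
  obtain U where U: "\<And>k. C_k 1 (U k)" "L2_tendsto \<Omega> (\<lambda>k. grad (U k)) G"
    "(\<lambda>k. \<integral>\<^sup>+x. ennreal \<bar>U k x - g x\<bar> \<partial>surface_measure \<Omega>) \<longlonglongrightarrow> 0"
    and g: "integrable (surface_measure \<Omega>) g"
    using trace by (auto simp: boundary_trace_def)
  have "(\<lambda>k. LINT x|lebesgue_on \<Omega>. grad (U k) x) \<longlonglongrightarrow> (LINT x|lebesgue_on \<Omega>. G x)"
    by (intro L2_tendsto_integral[OF domain_lmeasurable _ G U(2)] integrable_continuous_lebesgue_on
        domain_lmeasurable domain_bounded continuous_grad U(1))
  moreover have "(\<lambda>k. LINT x|surface_measure \<Omega>. U k x *\<^sub>R \<nu> x)
      \<longlonglongrightarrow> (LINT x|surface_measure \<Omega>. g x *\<^sub>R \<nu> x)"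
  proof (rule tendsto_L1_int)
    \<comment> \<open>Multiplying by a unit vector does not change the length of the
      difference.\<close>
    have "(\<integral>\<^sup>+x. ennreal (norm (U k x *\<^sub>R \<nu> x - g x *\<^sub>R \<nu> x)) \<partial>surface_measure \<Omega>)
        = (\<integral>\<^sup>+x. ennreal \<bar>U k x - g x\<bar> \<partial>surface_measure \<Omega>)" for k
      by (rule nn_integral_cong_AE, use norm_normal in eventually_elim)
         (simp flip: scaleR_left_diff_distrib)
    then show "(\<lambda>k. \<integral>\<^sup>+x. ennreal (norm (U k x *\<^sub>R \<nu> x - g x *\<^sub>R \<nu> x)) \<partial>surface_measure \<Omega>)
        \<longlonglongrightarrow> 0"
      using U(3) by simp
  qed (use U g in \<open>auto intro!: integrable_scaleR_normal integrable_surface_continuous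
      C_k_1_continuous\<close>)
  ultimately show ?thesis
    using gradient_theorem[OF U(1)] by (simp add: LIMSEQ_unique)
qed

text \<open>Weighting the flux by a coordinate isolates one component of the field, since the
  gradient of that coordinate is a basis vector. The remaining volume term contains the divergence,
  which tends to 0 in L^2.\<close>

lemma integral_normal_trace:
  assumes trace: "normal_trace \<Omega> \<nu> F (\<lambda>x. 0) \<Lambda>" and F: "integrable (lebesgue_on \<Omega>) F"
  shows "(LINT x|lebesgue_on \<Omega>. F x) = (\<chi> i. \<Lambda> (\<lambda>x. x $ i))"
proof (rule vec_eq_iff[THEN iffD2], rule allI)
  fix i
  obtain P where P: "\<And>k. C_k 1 (P k)" "L2_tendsto \<Omega> P F"
    "L2_tendsto \<Omega> (\<lambda>k. divergence (P k)) (\<lambda>x. 0)"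
    and \<Lambda>: "(\<lambda>k. LINT x|surface_measure \<Omega>. x $ i * (P k x \<bullet> \<nu> x)) \<longlonglongrightarrow> \<Lambda> (\<lambda>x. x $ i)"
    using trace C_k_1_component[of i] unfolding normal_trace_def by blast
  note int = integrable_continuous_lebesgue_on[OF domain_lmeasurable domain_bounded]
  have cont: "continuous_on UNIV (\<lambda>x. x $ i * divergence (P k) x)" for k
    by (intro continuous_intros continuous_divergence P)
  have intP: "integrable (lebesgue_on \<Omega>) (P k)" for k
    by (intro int C_k_1_continuous P)
  have parts: "(LINT x|surface_measure \<Omega>. x $ i * (P k x \<bullet> \<nu> x))
      = (LINT x|lebesgue_on \<Omega>. P k x) $ i + (LINT x|lebesgue_on \<Omega>. x $ i * divergence (P k) x)" for k
    using integration_by_parts[OF C_k_1_component[of i] P(1)[of k]] int[OF cont] intP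
    by (simp add: grad_component inner_axis' integrable_bounded_linear[OF bounded_linear_vec_nth]
        flip: integral_bounded_linear[OF bounded_linear_vec_nth])
  have limP: "(\<lambda>k. (LINT x|lebesgue_on \<Omega>. P k x) $ i) \<longlonglongrightarrow> (LINT x|lebesgue_on \<Omega>. F x) $ i"
    by (intro tendsto_vec_nth L2_tendsto_integral intP F P domain_lmeasurable)
  \<comment> \<open>A bounded coordinate cannot spoil the decay of the divergence: the product has
    L^1 norm at most \<open>B\<close> times that of the divergence.\<close>
  obtain B where B: "B > 0" "\<And>x. x \<in> \<Omega> \<Longrightarrow> norm (x $ i) \<le> B"
    using continuous_bounded_on_bounded[OF domain_bounded, of "\<lambda>x. x $ i"]
      C_k_1_continuous[OF C_k_1_component] by blast
  have "(\<lambda>k. LINT x|lebesgue_on \<Omega>. x $ i * divergence (P k) x) \<longlonglongrightarrow> (LINT x|lebesgue_on \<Omega>. 0)"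
  proof (rule tendsto_L1_int)
    let ?d = "\<lambda>k. \<integral>\<^sup>+x. ennreal (norm (divergence (P k) x - 0)) \<partial>lebesgue_on \<Omega>"
    have "?d \<longlonglongrightarrow> 0"
      using int[OF continuous_divergence[OF P(1)]]
      by (intro L2_tendsto_imp_L1 domain_lmeasurable P) auto
    then have lim: "(\<lambda>k. ennreal B * ?d k) \<longlonglongrightarrow> 0"
      using ennreal_tendsto_cmult[of "ennreal B" ?d 0] by simp
    have le: "(\<integral>\<^sup>+x. ennreal (norm (x $ i * divergence (P k) x - 0)) \<partial>lebesgue_on \<Omega>)
        \<le> ennreal B * ?d k" for k
    proof -
      have "(\<integral>\<^sup>+x. ennreal (norm (x $ i * divergence (P k) x - 0)) \<partial>lebesgue_on \<Omega>)
          \<le> (\<integral>\<^sup>+x. ennreal B * ennreal (norm (divergence (P k) x - 0)) \<partial>lebesgue_on \<Omega>)"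
        using B by (intro nn_integral_mono)
          (auto simp: abs_mult simp flip: ennreal_mult' intro!: ennreal_leI mult_right_mono)
      also have "\<dots> = ennreal B * ?d k"
        using int[OF continuous_divergence[OF P(1)]] by (intro nn_integral_cmult) auto
      finally show ?thesis .
    qed
    show "(\<lambda>k. \<integral>\<^sup>+x. ennreal (norm (x $ i * divergence (P k) x - 0)) \<partial>lebesgue_on \<Omega>)
        \<longlonglongrightarrow> 0"
      by (intro tendsto_sandwich[OF _ _ tendsto_const lim] always_eventually allI le) simp
  qed (use int[OF cont] in auto)
  from tendsto_add[OF limP this] \<Lambda>
  show "(LINT x|lebesgue_on \<Omega>. F x) $ i = (\<chi> i. \<Lambda> (\<lambda>x. x $ i)) $ i"
    by (simp add: parts LIMSEQ_unique)
qed

end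

section \<open>Phase averages and the breakdown bound\<close>

lemma average_norm_le:
  fixes f :: "'a::euclidean_space \<Rightarrow> 'b::euclidean_space"
  assumes S: "S \<in> lmeasurable" "measure lebesgue S > 0"
    and f: "integrable (lebesgue_on S) f" "AE x in lebesgue_on S. norm (f x) \<le> c"
  shows "norm ((1 / measure lebesgue S) *\<^sub>R (LINT x|lebesgue_on S. f x)) \<le> c"
proof -
  interpret finite_measure "lebesgue_on S"
    by (rule finite_measure_lebesgue_on[OF S(1)])
  \<comment> \<open>The length of a mean is at most the mean of the lengths.\<close>
  have "norm (LINT x|lebesgue_on S. f x) \<le> (LINT x|lebesgue_on S. norm (f x))"
    by simp
  also have "\<dots> \<le> (LINT x|lebesgue_on S. c)"
    using f by (intro integral_mono_AE) auto
  also have "\<dots> = measure lebesgue S * c"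
    using S by (simp add: measure_restrict_space)
  finally show ?thesis
    using S by (simp add: divide_simps mult.commute)
qed

theorem mainTheorem3:
  fixes \<Omega> \<Omega>1 \<Omega>2 :: "(real^'d) set"
    and \<nu> E J :: "real^'d \<Rightarrow> real^'d"
    and V g \<sigma> :: "real^'d \<Rightarrow> real"
    and \<Lambda> :: "(real^'d \<Rightarrow> real) \<Rightarrow> real"
    and \<sigma>1 \<sigma>2 f1 f2 c1 c2 :: real
    and Emean Jmean E1 E2 :: "real^'d"
  assumes dim: "CARD('d) = 2 \<or> CARD('d) = 3"
    and domain: "divergence_theorem_domain \<Omega> \<nu>"
    and phases: "\<Omega>1 \<in> sets lebesgue" "\<Omega>2 \<in> sets lebesgue" "\<Omega>1 \<subseteq> \<Omega>" "\<Omega>2 \<subseteq> \<Omega>"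
      "AE x in lebesgue_on \<Omega>. indicator \<Omega>1 x + indicator \<Omega>2 x = (1::real)"
    and fractions: "f1 = measure lebesgue \<Omega>1 / measure lebesgue \<Omega>"
      "f2 = measure lebesgue \<Omega>2 / measure lebesgue \<Omega>" "f1 > 0" "f2 > 0"
    and thresholds: "c1 > 0" "c2 > 0"
    and conductivity: "\<sigma>1 \<noteq> \<sigma>2" "\<sigma> = (\<lambda>x. \<sigma>1 * indicator \<Omega>1 x + \<sigma>2 * indicator \<Omega>2 x)"
    and field: "weak_gradient \<Omega> V (\<lambda>x. - E x)"
    and current: "J = (\<lambda>x. \<sigma> x *\<^sub>R E x)" "weakly_divergence_free \<Omega> J"
    and boundary_values: "boundary_trace \<Omega> V (\<lambda>x. - E x) g"
    and boundary_flux: "normal_trace \<Omega> \<nu> J (\<lambda>x. 0) \<Lambda>"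
    and Emean: "Emean = - ((1 / measure lebesgue \<Omega>) *\<^sub>R (LINT x|surface_measure \<Omega>. g x *\<^sub>R \<nu> x))"
    and Jmean: "Jmean = (1 / measure lebesgue \<Omega>) *\<^sub>R (\<chi> i. \<Lambda> (\<lambda>x. x $ i))"
    and E1: "E1 = (1 / (f1 * (\<sigma>1 - \<sigma>2))) *\<^sub>R (Jmean - \<sigma>2 *\<^sub>R Emean)"
    and E2: "E2 = (1 / (f2 * (\<sigma>2 - \<sigma>1))) *\<^sub>R (Jmean - \<sigma>1 *\<^sub>R Emean)"
  shows "E1 = (1 / measure lebesgue \<Omega>1) *\<^sub>R (LINT x|lebesgue_on \<Omega>1. E x)
       \<and> E2 = (1 / measure lebesgue \<Omega>2) *\<^sub>R (LINT x|lebesgue_on \<Omega>2. E x)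
       \<and> ((AE x in lebesgue_on \<Omega>1. norm (E x) < c1) \<and> (AE x in lebesgue_on \<Omega>2. norm (E x) < c2)
            \<longrightarrow> norm E1 \<le> c1 \<and> norm E2 \<le> c2)"
proof -
  have \<Omega>: "\<Omega> \<in> lmeasurable"
    by (rule domain_lmeasurable[OF domain])
  have lm: "\<Omega>1 \<in> lmeasurable" "\<Omega>2 \<in> lmeasurable"
    using \<Omega> phases by (auto intro: fmeasurableI2)
  \<comment> \<open>A positive quotient of nonnegative measures has positive numerator and
    denominator; a zero denominator would give the default quotient 0.\<close>
  have pos: "measure lebesgue \<Omega> > 0" "measure lebesgue \<Omega>1 > 0" "measure lebesgue \<Omega>2 > 0"
    using fractions by (auto simp: zero_less_divide_iff leD[OF measure_nonneg])
  have intE: "integrable (lebesgue_on \<Omega>) E"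
    using square_integrable_on_imp_integrable[OF \<Omega>, of "\<lambda>x. - E x"] field
    by (simp add: weak_gradient_def)
  have intJ: "integrable (lebesgue_on \<Omega>) J"
    using square_integrable_on_imp_integrable[OF \<Omega>] current(2)
    unfolding weakly_divergence_free_def by blast

  \<comment> \<open>Phase integrals are rewritten over the whole domain with indicator weights, so
    that they can be added and compared with the integrals of \<open>E\<close> and
    \<open>J\<close>.\<close>
  have phase: "integrable (lebesgue_on \<Omega>) (\<lambda>x. indicator A x *\<^sub>R E x)"
    "integrable (lebesgue_on A) E"
    "(LINT x|lebesgue_on A. E x) = (LINT x|lebesgue_on \<Omega>. indicator A x *\<^sub>R E x)"
    if "A \<in> sets lebesgue" "A \<subseteq> \<Omega>" for A
  proof -
    have ind: "indicator \<Omega> x * indicator A x = (indicator A x :: real)" for x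
      using that by (auto simp: indicator_def)
    have "A \<in> sets (lebesgue_on \<Omega>)"
      using that \<Omega> by (auto simp: sets_restrict_space_iff)
    then show I: "integrable (lebesgue_on \<Omega>) (\<lambda>x. indicator A x *\<^sub>R E x)"
      by (rule integrable_mult_indicator[OF _ intE])
    show "integrable (lebesgue_on A) E"
      using I that \<Omega> by (simp add: integrable_restrict_space ind fmeasurableD)
    show "(LINT x|lebesgue_on A. E x) = (LINT x|lebesgue_on \<Omega>. indicator A x *\<^sub>R E x)"
      using that \<Omega> by (simp add: integral_restrict_space ind fmeasurableD)
  qed
  note phase1 = phase[OF phases(1,3)] and phase2 = phase[OF phases(2,4)]
  define I1 where "I1 = (LINT x|lebesgue_on \<Omega>1. E x)"
  define I2 where "I2 = (LINT x|lebesgue_on \<Omega>2. E x)"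

  have "(LINT x|lebesgue_on \<Omega>. E x)
      = (LINT x|lebesgue_on \<Omega>. indicator \<Omega>1 x *\<^sub>R E x + indicator \<Omega>2 x *\<^sub>R E x)"
  proof (rule integral_cong_AE)
    show "AE x in lebesgue_on \<Omega>. E x = indicator \<Omega>1 x *\<^sub>R E x + indicator \<Omega>2 x *\<^sub>R E x"
      using phases(5) by eventually_elim (simp flip: scaleR_left_distrib)
  qed (use intE phase1(1) phase2(1) in auto)
  then have E_sum: "(LINT x|lebesgue_on \<Omega>. E x) = I1 + I2"
    using phase1 phase2 by (simp add: I1_def I2_def)
  \<comment> \<open>This splitting is exact at every point, because \<open>\<sigma>\<close> is
    itself given by the indicators; that of \<open>E\<close> holds only almost everywhere.\<close>
  have "J = (\<lambda>x. \<sigma>1 *\<^sub>R indicator \<Omega>1 x *\<^sub>R E x + \<sigma>2 *\<^sub>R indicator \<Omega>2 x *\<^sub>R E x)"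
    by (simp add: current(1) conductivity(2) scaleR_left_distrib)
  then have J_sum: "(LINT x|lebesgue_on \<Omega>. J x) = \<sigma>1 *\<^sub>R I1 + \<sigma>2 *\<^sub>R I2"
    using phase1 phase2 by (simp add: I1_def I2_def del: scaleR_scaleR)

  \<comment> \<open>The weak gradient of \<open>V\<close> is \<open>- E\<close>; its sign cancels
    the one in \<open>Emean\<close>.\<close>
  have "- (LINT x|lebesgue_on \<Omega>. E x) = (LINT x|surface_measure \<Omega>. g x *\<^sub>R \<nu> x)"
    using integral_boundary_trace[OF domain boundary_values] intE by simp
  then have Em: "Emean = (1 / measure lebesgue \<Omega>) *\<^sub>R (I1 + I2)"
    unfolding Emean by (metis E_sum add.inverse_inverse scaleR_minus_right)
  have Jm: "Jmean = (1 / measure lebesgue \<Omega>) *\<^sub>R (\<sigma>1 *\<^sub>R I1 + \<sigma>2 *\<^sub>R I2)"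
    using integral_normal_trace[OF domain boundary_flux intJ] by (simp add: Jmean J_sum)
  \<comment> \<open>This combination eliminates \<open>I2\<close>. Dividing by
    \<open>f1 * (\<sigma>1 - \<sigma>2)\<close> then cancels the contrast and the volume of
    \<open>\<Omega>\<close>, leaving the volume of phase 1.\<close>
  have "Jmean - \<sigma>2 *\<^sub>R Emean = ((\<sigma>1 - \<sigma>2) / measure lebesgue \<Omega>) *\<^sub>R I1"
    by (simp add: Em Jm algebra_simps diff_divide_distrib)
  then have avg1: "E1 = (1 / measure lebesgue \<Omega>1) *\<^sub>R I1"
    using conductivity(1) pos by (simp add: E1 fractions(1))
  have "Jmean - \<sigma>1 *\<^sub>R Emean = ((\<sigma>2 - \<sigma>1) / measure lebesgue \<Omega>) *\<^sub>R I2"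
    by (simp add: Em Jm algebra_simps diff_divide_distrib)
  then have avg2: "E2 = (1 / measure lebesgue \<Omega>2) *\<^sub>R I2"
    using conductivity(1) pos by (simp add: E2 fractions(2))
  \<comment> \<open>The strict local bound is weakened to a non-strict one and averaged.\<close>
  have "norm E1 \<le> c1" if "AE x in lebesgue_on \<Omega>1. norm (E x) < c1"
    unfolding avg1 I1_def using that
    by (intro average_norm_le lm pos phase1) (auto elim: eventually_mono)
  moreover have "norm E2 \<le> c2" if "AE x in lebesgue_on \<Omega>2. norm (E x) < c2"
    unfolding avg2 I2_def using that
    by (intro average_norm_le lm pos phase2) (auto elim: eventually_mono)
  ultimately show ?thesis
    using avg1 avg2 by (simp add: I1_def I2_def)
qed

end
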